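(* Let $\Delta=\operatorname{conv}\{(0,0),(3,0),(0,1)\}\subset\mathbb R^2$. Every polynomial whose support is exactly $\operatorname{Vert}(\Delta)=\{(0,0),(3,0),(0,1)\}$, i.e. every $g(z,w)=a+bz^3+cw$ with $a,b,c\in\mathbb C^*$, has a contour $\mathcal C(\mathscr A_g)$ without (finite) singularities, whereas $f(z,w)=w-1+z-z^3$ has Newton polygon $\Delta$ and its contour $\mathcal C(\mathscr A_f)$ has an ordinary node at $(0,0)$. Hence the supremum of the number of isolated contour singularities over all polynomials with Newton polygon $\Delta$ is not attained in the subfamily of polynomials supported exactly on $\operatorname{Vert}(\Delta)$.
   Context: For a polynomial $g\in\mathbb C[z,w]$ let $V_g=\{g=0\}\subset(\mathbb C^* )^2$ and $\operatorname{Log}(z,w)=(\log|z|,\log|w|)$. The contour $\mathcal C(\mathscr A_g)\subset\mathbb R^2$ of the amoeba $\mathscr A_g=\operatorname{Log}(V_g)$ is the set of critical values of $\operatorname{Log}|_{V_g}:V_g\to\mathbb R^2$, i.e. the image under $\operatorname{Log}$ of the set of points of $V_g$ where the real differential of $\operatorname{Log}|_{V_g}$ has rank less than $2$. The support of a polynomial is the set of exponents of monomials with nonzero coefficient, and the Newton polygon is the convex hull of the support. A point $p$ of the contour is regular if the contour is a smooth embedded real curve in a neighborhood of $p$ in $\mathbb R^2$, and singular otherwise; an isolated contour singularity is an isolated point of the set of singular points. "Finite" means lying in $\mathbb R^2$. An ordinary node is a contour point near which the contour is the union of two smooth embedded curve branches meeting transversally at that point. *)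

theory Defs
  imports
    "HOL-Analysis.Analysis"
    "HOL-Computational_Algebra.Polynomial"
    "HOL-Library.Extended_Nat"
begin

text \<open>
  Polynomials in \<open>z\<close> and \<open>w\<close> over the complex numbers are represented as polynomials in \<open>w\<close>
  whose coefficients are polynomials in \<open>z\<close>.
\<close>

type_synonym bipoly = "complex poly poly"

definition const2 :: "complex \<Rightarrow> bipoly" where
  "const2 a = [:[:a:]:]"

definition varz :: bipoly where
  "varz = [:[:0, 1:]:]"

definition varw :: bipoly where
  "varw = [:0, 1:]"

definition eval2 :: "bipoly \<Rightarrow> complex \<times> complex \<Rightarrow> complex" where
  "eval2 g = (\<lambda>(z, w). poly (poly g [:w:]) z)"

text \<open>The exponent pair \<open>(i, j)\<close> stands for the monomial \<open>z^i * w^j\<close>.\<close>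

definition support2 :: "bipoly \<Rightarrow> (nat \<times> nat) set" where
  "support2 g = {(i, j). coeff (coeff g j) i \<noteq> 0}"

definition real_support :: "bipoly \<Rightarrow> (real \<times> real) set" where
  "real_support g = (\<lambda>(i, j). (real i, real j)) ` support2 g"

definition newton_polygon :: "bipoly \<Rightarrow> (real \<times> real) set" where
  "newton_polygon g = convex hull (real_support g)"

definition vertices :: "(real \<times> real) set \<Rightarrow> (real \<times> real) set" where
  "vertices P = {v. v extreme_point_of P}"

definition torus_curve :: "bipoly \<Rightarrow> (complex \<times> complex) set" where
  "torus_curve g = {(z, w). z \<noteq> 0 \<and> w \<noteq> 0 \<and> eval2 g (z, w) = 0}"

definition Log :: "complex \<times> complex \<Rightarrow> real \<times> real" where
  "Log = (\<lambda>(z, w). (ln (cmod z), ln (cmod w)))"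

text \<open>
  The tangent space of the curve at a point where \<open>dg\<close> does not vanish. The real derivative of
  \<open>g\<close> is complex linear, so its kernel is then a complex line.
\<close>

definition curve_tangent :: "bipoly \<Rightarrow> complex \<times> complex \<Rightarrow> (complex \<times> complex) set" where
  "curve_tangent g p = {v. frechet_derivative (eval2 g) (at p) v = 0}"

text \<open>
  Below, \<open>dim\<close> is the real dimension, so it is the rank of the differential of \<open>Log\<close> restricted
  to the curve. At a point where \<open>dg\<close> vanishes the kernel is everything and the rank is 2, so that
  such points are never counted as critical; they do not occur if \<open>g\<close> has Newton polygon
  \<open>conv {(0,0), (3,0), (0,1)}\<close>, since then the derivative of \<open>g\<close> in \<open>w\<close> is a nonzero constant.
\<close>

definition log_critical_points :: "bipoly \<Rightarrow> (complex \<times> complex) set" where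
  "log_critical_points g =
     {p \<in> torus_curve g. dim (frechet_derivative Log (at p) ` curve_tangent g p) < 2}"

definition contour :: "bipoly \<Rightarrow> (real \<times> real) set" where
  "contour g = Log ` log_critical_points g"

text \<open>
  \<open>A\<close> is an embedded C-infinity arc without endpoints, regularly parametrized by \<open>\<gamma>\<close> on the
  interval \<open>(-1, 1)\<close>. The function \<open>D n\<close> is the derivative of \<open>\<gamma>\<close> of order \<open>n\<close>, so smoothness
  means C-infinity, and \<open>A\<close> carries the subspace topology.
\<close>

definition smooth_embedded_arc :: "(real \<Rightarrow> real \<times> real) \<Rightarrow> (real \<times> real) set \<Rightarrow> bool" where
  "smooth_embedded_arc \<gamma> A \<longleftrightarrow>
     (\<exists>D :: nat \<Rightarrow> real \<Rightarrow> real \<times> real.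
        D 0 = \<gamma> \<and>
        (\<forall>n. \<forall>t\<in>{-1<..<1}. (D n has_vector_derivative D (Suc n) t) (at t)) \<and>
        (\<forall>t\<in>{-1<..<1}. D 1 t \<noteq> 0)) \<and>
     (\<exists>\<tau>. homeomorphism {-1<..<1} A \<gamma> \<tau>)"

definition regular_at :: "(real \<times> real) set \<Rightarrow> real \<times> real \<Rightarrow> bool" where
  "regular_at C p \<longleftrightarrow>
     p \<in> C \<and> (\<exists>U \<gamma>. open U \<and> p \<in> U \<and> smooth_embedded_arc \<gamma> (C \<inter> U))"

definition singular_points :: "(real \<times> real) set \<Rightarrow> (real \<times> real) set" where
  "singular_points C = {p \<in> C. \<not> regular_at C p}"

definition isolated_singularities :: "(real \<times> real) set \<Rightarrow> (real \<times> real) set" where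
  "isolated_singularities C = {p. p isolated_in singular_points C}"

definition num_isolated_singularities :: "(real \<times> real) set \<Rightarrow> enat" where
  "num_isolated_singularities C =
     (if finite (isolated_singularities C) then enat (card (isolated_singularities C)) else \<infinity>)"

definition ordinary_node :: "(real \<times> real) set \<Rightarrow> real \<times> real \<Rightarrow> bool" where
  "ordinary_node C p \<longleftrightarrow>
     (\<exists>U A B \<alpha> \<beta>. open U \<and> p \<in> U \<and> C \<inter> U = A \<union> B \<and>
        smooth_embedded_arc \<alpha> A \<and> smooth_embedded_arc \<beta> B \<and>
        \<alpha> 0 = p \<and> \<beta> 0 = p \<and>
        span {vector_derivative \<alpha> (at 0), vector_derivative \<beta> (at 0)} = UNIV)"

definition Delta :: "(real \<times> real) set" where
  "Delta = convex hull {(0, 0), (3, 0), (0, 1)}"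

definition f_node :: bipoly where
  "f_node = varw - 1 + varz - varz ^ 3"

end

theory Submission
  imports Defs "HOL-Complex_Analysis.Cauchy_Integral_Formula"
begin

text \<open>
  All polynomials considered are affine in \<open>w\<close>, so the curve is the graph of a polynomial \<open>q\<close> in
  \<open>z\<close>, up to a constant factor. In the coordinate \<open>log z\<close> the differential of \<open>Log\<close> on such a curve
  is \<open>u \<mapsto> (Re u, Re (l u))\<close> with \<open>l = z q'(z) / q(z)\<close>. Hence a point is critical exactly if the
  logarithmic Gauss map \<open>l\<close> is real there (\<open>contour_graph_iff\<close>).

  For \<open>q = a + b z^3\<close> the map \<open>l\<close> depends only on \<open>u = b z^3 / a\<close>, and it is real exactly if \<open>u\<close> is.
  As \<open>u\<close> runs over the positive and over the negative numbers, the contour is the union of the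
  curves \<open>exp y = \<bar>m + n exp (3 x)\<bar>\<close> and \<open>exp y = \<bar>m - n exp (3 x)\<bar>\<close> with \<open>m, n > 0\<close>. These are
  disjoint, and each is the graph of an analytic function over the set where the right-hand side
  does not vanish, so the contour is smooth (\<open>contour_binomial_smooth\<close>).

  For \<open>f = w - 1 + z - z^3\<close> every real \<open>z\<close> with \<open>z w \<noteq> 0\<close> gives a critical point, and \<open>z = 1\<close> and
  \<open>z = -1\<close> both lie over the origin. The other critical points lie on a real cubic in the \<open>z\<close>-plane that contains no \<open>z\<close> with
  \<open>\<bar>z\<bar> = \<bar>w\<bar> = 1\<close>; by compactness it stays away from the fibre over the origin. So near the
  origin the contour consists of the images of the positive and of the negative real axis, which
  have slopes \<open>2\<close> and \<open>-2\<close> (\<open>contour_f_node_near_origin\<close>). They meet only at the origin. This is an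
  ordinary node, and an embedded arc has a single tangent line, so the node is a singular point
  (\<open>not_regular_at_crossing\<close>), isolated because the two branches separate away from it. The
  supremum is therefore at least \<open>1\<close>, while the binomial family only gives \<open>0\<close>.
\<close>

section \<open>Critical points of the logarithmic map on a graph\<close>

lemma has_derivative_ln_cmod:
  assumes "z \<noteq> 0"
  shows "((\<lambda>z. ln (cmod z)) has_derivative (\<lambda>v. Re (v / z))) (at z)"
proof -
  have "((\<lambda>z. ln (cmod z)) has_derivative (\<lambda>v. inner v (sgn z) / cmod z)) (at z)"
    using has_derivative_compose[OF has_derivative_norm[OF assms]
        DERIV_ln_divide[THEN has_field_derivative_imp_has_derivative, of "cmod z"]] assms
    by simp
  also have "(\<lambda>v. inner v (sgn z) / cmod z) = (\<lambda>v. Re (v / z))"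
  proof
    fix v
    have "inner v (sgn z) / cmod z = (Re v * Re z + Im v * Im z) / (cmod z)^2"
      by (simp add: inner_complex_def sgn_div_norm power2_eq_square divide_inverse algebra_simps)
    also have "\<dots> = Re (v / z)"
      by (simp add: Re_divide cmod_power2)
    finally show "inner v (sgn z) / cmod z = Re (v / z)" .
  qed
  finally show ?thesis .
qed

lemma frechet_derivative_Log:
  assumes "z \<noteq> 0" "w \<noteq> 0"
  shows "frechet_derivative Log (at (z, w)) = (\<lambda>(u, v). (Re (u / z), Re (v / w)))"
proof -
  have 1: "((\<lambda>p. ln (cmod (fst p))) has_derivative (\<lambda>v. Re (fst v / z))) (at (z, w))"
    using has_derivative_compose[OF bounded_linear_imp_has_derivative[OF bounded_linear_fst, of "at (z, w)"],
        of "\<lambda>z. ln (cmod z)" "\<lambda>v. Re (v / z)"] has_derivative_ln_cmod[OF assms(1)] by simp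
  have 2: "((\<lambda>p. ln (cmod (snd p))) has_derivative (\<lambda>v. Re (snd v / w))) (at (z, w))"
    using has_derivative_compose[OF bounded_linear_imp_has_derivative[OF bounded_linear_snd, of "at (z, w)"],
        of "\<lambda>z. ln (cmod z)" "\<lambda>v. Re (v / w)"] has_derivative_ln_cmod[OF assms(2)] by simp
  have "(Log has_derivative (\<lambda>(u, v). (Re (u / z), Re (v / w)))) (at (z, w))"
    using has_derivative_Pair[OF 1 2] by (simp add: Log_def case_prod_unfold)
  then show ?thesis
    by (rule frechet_derivative_at[symmetric])
qed

lemma frechet_derivative_graph_polynomial:
  assumes "\<And>z w. eval2 g (z, w) = poly q z + c * w"
  shows "frechet_derivative (eval2 g) (at (z, w)) = (\<lambda>(u, v). poly (pderiv q) z * u + c * v)"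
proof -
  have eq: "eval2 g = (\<lambda>p. poly q (fst p) + c * snd p)"
    using assms by (auto simp: fun_eq_iff)
  have 1: "((\<lambda>p. poly q (fst p)) has_derivative (\<lambda>v. poly (pderiv q) z * fst v)) (at (z, w))"
    using has_derivative_compose[OF bounded_linear_imp_has_derivative[OF bounded_linear_fst, of "at (z, w)"],
        of "poly q" "\<lambda>v. poly (pderiv q) z * v"] poly_DERIV[of q z]
    by (simp add: has_field_derivative_def)
  have "(eval2 g has_derivative (\<lambda>(u, v). poly (pderiv q) z * u + c * v)) (at (z, w))"
    unfolding eq case_prod_unfold
    by (intro has_derivative_add 1 has_derivative_mult_right has_derivative_snd has_derivative_ident)
  then show ?thesis
    by (rule frechet_derivative_at[symmetric])
qed

text \<open>
  If \<open>l\<close> is real then the map \<open>u \<mapsto> (Re u, Re (l u))\<close> sees only \<open>Re u\<close>; otherwise \<open>Im u\<close> can be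
  used to adjust the second component freely.
\<close>

lemma dim_real_parts_lt_2_iff:
  "dim (range (\<lambda>u. (Re u, Re (l * u)))) < 2 \<longleftrightarrow> Im l = 0"
proof
  assume "Im l = 0"
  then have "range (\<lambda>u. (Re u, Re (l * u))) \<subseteq> span {(1, Re l)}"
    by (auto simp: span_singleton)
  then have "dim (range (\<lambda>u. (Re u, Re (l * u)))) \<le> card {(1 :: real, Re l)}"
    by (rule dim_le_card) simp
  then show "dim (range (\<lambda>u. (Re u, Re (l * u)))) < 2" by simp
next
  assume less: "dim (range (\<lambda>u. (Re u, Re (l * u)))) < 2"
  show "Im l = 0"
  proof (rule ccontr)
    assume "Im l \<noteq> 0"
    then have "(x, y) = (\<lambda>u. (Re u, Re (l * u))) (Complex x ((Re l * x - y) / Im l))" for x y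
      by simp
    then have "range (\<lambda>u. (Re u, Re (l * u))) = UNIV"
      by (metis (no_types, lifting) UNIV_eq_I rangeI surj_pair)
    with less show False
      by simp
  qed
qed

text \<open>
  The tangent line at \<open>(z, w)\<close> is spanned over the complex numbers by \<open>(z, w l)\<close>, where \<open>l\<close> is the
  logarithmic derivative \<open>z q'(z) / q(z)\<close>. The differential of \<open>Log\<close> divides the coordinates by
  \<open>z\<close> and \<open>w\<close> and takes real parts.
\<close>

lemma critical_graph_iff:
  assumes g: "\<And>z w. eval2 g (z, w) = poly q z + c * w" and c: "c \<noteq> 0"
  shows "(z, w) \<in> log_critical_points g \<longleftrightarrow>
    z \<noteq> 0 \<and> poly q z \<noteq> 0 \<and> w = - poly q z / c \<and> Im (z * poly (pderiv q) z / poly q z) = 0"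
proof -
  have w: "poly q z + c * w = 0 \<longleftrightarrow> w = - poly q z / c"
    using c by (auto simp: field_simps add_eq_0_iff)
  have "dim (frechet_derivative Log (at (z, w)) ` curve_tangent g (z, w)) < 2 \<longleftrightarrow>
      Im (z * poly (pderiv q) z / poly q z) = 0"
    if z: "z \<noteq> 0" and q: "poly q z \<noteq> 0" and weq: "w = - poly q z / c"
  proof -
    define l where "l = z * poly (pderiv q) z / poly q z"
    have w0: "w \<noteq> 0" using q c weq by simp
    have ker: "poly (pderiv q) z * u + c * v = 0 \<longleftrightarrow> v = w * l * (u / z)" for u v
      using c z q unfolding weq l_def by (auto simp: field_simps add_eq_0_iff)
    have tangent: "curve_tangent g (z, w) = range (\<lambda>u. (z * u, w * (l * u)))"
    proof (intro set_eqI iffI)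
      fix p assume "p \<in> curve_tangent g (z, w)"
      then obtain u v where p: "p = (u, v)" and "poly (pderiv q) z * u + c * v = 0"
        unfolding curve_tangent_def frechet_derivative_graph_polynomial[OF g] by (cases p) simp
      then have "p = (z * (u / z), w * (l * (u / z)))"
        using z ker by (simp add: mult.assoc)
      then show "p \<in> range (\<lambda>u. (z * u, w * (l * u)))" by blast
    next
      fix p assume "p \<in> range (\<lambda>u. (z * u, w * (l * u)))"
      then obtain u where p: "p = (z * u, w * (l * u))" by blast
      show "p \<in> curve_tangent g (z, w)"
        unfolding curve_tangent_def frechet_derivative_graph_polynomial[OF g] p
        using ker[of "z * u" "w * (l * u)"] z by (simp add: mult.assoc)
    qed
    have "frechet_derivative Log (at (z, w)) ` curve_tangent g (z, w) =
        range (\<lambda>u. (Re u, Re (l * u)))"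
      unfolding tangent frechet_derivative_Log[OF z w0] image_image using z w0 by simp
    then show ?thesis
      by (simp only: dim_real_parts_lt_2_iff l_def)
  qed
  then show ?thesis
    using c by (auto simp: log_critical_points_def torus_curve_def g w)
qed

text \<open>
  The two norm equations also force \<open>z\<close> and \<open>q(z)\<close> to be nonzero.
\<close>

lemma contour_graph_iff:
  assumes g: "\<And>z w. eval2 g (z, w) = poly q z + c * w" and c: "c \<noteq> 0"
  shows "(x, y) \<in> contour g \<longleftrightarrow>
    (\<exists>z. cmod z = exp x \<and> cmod (poly q z) = cmod c * exp y \<and>
      Im (z * poly (pderiv q) z / poly q z) = 0)"
proof
  assume "(x, y) \<in> contour g"
  then obtain z w where "(z, w) \<in> log_critical_points g" and xy: "(x, y) = Log (z, w)"
    unfolding contour_def by (auto simp del: split_paired_Ex)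
  then have "z \<noteq> 0" "poly q z \<noteq> 0" "w = - poly q z / c" "Im (z * poly (pderiv q) z / poly q z) = 0"
    using critical_graph_iff[OF g c] by auto
  with xy c show "\<exists>z. cmod z = exp x \<and> cmod (poly q z) = cmod c * exp y \<and>
      Im (z * poly (pderiv q) z / poly q z) = 0"
    by (intro exI[of _ z]) (auto simp: Log_def norm_divide)
next
  assume "\<exists>z. cmod z = exp x \<and> cmod (poly q z) = cmod c * exp y \<and>
      Im (z * poly (pderiv q) z / poly q z) = 0"
  then obtain z where z: "cmod z = exp x" and q: "cmod (poly q z) = cmod c * exp y"
    and im: "Im (z * poly (pderiv q) z / poly q z) = 0"
    by blast
  have "z \<noteq> 0" using z by auto
  moreover have "poly q z \<noteq> 0" using q c by (metis exp_not_eq_zero mult_eq_0_iff norm_eq_zero)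
  ultimately have "(z, - poly q z / c) \<in> log_critical_points g"
    using im by (simp add: critical_graph_iff[OF g c])
  moreover have "Log (z, - poly q z / c) = (x, y)"
    using z q c by (simp add: Log_def norm_divide)
  ultimately show "(x, y) \<in> contour g"
    unfolding contour_def by (metis imageI)
qed

section \<open>Curves given by real entire functions\<close>

text \<open>
  Infinitely many derivatives of a real function are most easily supplied at once by a holomorphic
  extension.
\<close>

definition real_entire :: "(real \<Rightarrow> real) \<Rightarrow> bool" where
  "real_entire f \<longleftrightarrow>
    (\<exists>F. F holomorphic_on UNIV \<and> (\<forall>x. F (complex_of_real x) = complex_of_real (f x)))"

text \<open>
  This is the graph of \<open>ln \<bar>f\<bar>\<close> over the set where \<open>f\<close> does not vanish: no \<open>y\<close> occurs over a zero of
  \<open>f\<close>. Written with \<open>exp\<close>, it is visibly closed in the plane, also near the zeros of \<open>f\<close>.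
\<close>

definition log_graph :: "(real \<Rightarrow> real) \<Rightarrow> (real \<times> real) set" where
  "log_graph f = {(x, y). exp y = \<bar>f x\<bar>}"

lemma holomorphic_extension_derivatives:
  fixes h :: "real \<Rightarrow> real"
  assumes hol: "F holomorphic_on T" "open T" and S: "open S"
    and ext: "\<And>x. x \<in> S \<Longrightarrow> complex_of_real x \<in> T \<and> F (complex_of_real x) = complex_of_real (h x)"
  shows "\<exists>D. D 0 = h \<and> (\<forall>n. \<forall>x\<in>S. (D n has_real_derivative D (Suc n) x) (at x))"
proof -
  define E where "E n x = Re ((deriv ^^ n) F (complex_of_real x))" for n and x :: real
  define D where "D n = (if n = 0 then h else E n)" for n
  have E: "(E n has_real_derivative E (Suc n) x) (at x)" if "x \<in> S" for n x
  proof -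
    have "((deriv ^^ n) F has_field_derivative (deriv ^^ Suc n) F (of_real x)) (at (of_real x))"
      using holomorphic_derivI[OF holomorphic_higher_deriv[OF hol] hol(2)] ext[OF that] by simp
    from has_vector_derivative_real_field[OF this, of UNIV]
    have "((\<lambda>x. Re ((deriv ^^ n) F (of_real x))) has_vector_derivative
        Re ((deriv ^^ Suc n) F (of_real x))) (at x)"
      by (rule bounded_linear.has_vector_derivative[OF bounded_linear_Re])
    then show ?thesis
      unfolding E_def has_real_derivative_iff_has_vector_derivative .
  qed
  have "(D n has_real_derivative D (Suc n) x) (at x)" if x: "x \<in> S" for n x
  proof (cases n)
    case 0
    show ?thesis unfolding D_def 0
      using has_field_derivative_transform_within_open[OF E[OF x, of 0] S x, of h] ext
      by (simp add: E_def)
  qed (use E[OF x] in \<open>simp add: D_def\<close>)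
  then show ?thesis by (intro exI[of _ D]) (auto simp: D_def)
qed

lemma real_entire_continuous: "real_entire f \<Longrightarrow> continuous_on S f"
proof -
  assume "real_entire f"
  then obtain F where F: "F holomorphic_on UNIV" "\<And>x. F (complex_of_real x) = complex_of_real (f x)"
    by (auto simp: real_entire_def)
  have "continuous_on S (\<lambda>x. Re (F (complex_of_real x)))"
    by (intro continuous_intros continuous_on_compose2[OF holomorphic_on_imp_continuous_on[OF F(1)]]) auto
  then show ?thesis by (simp add: F(2))
qed

text \<open>
  The holomorphic extension of \<open>ln \<bar>f\<bar>\<close> is half the logarithm of the square of the extension of
  \<open>f\<close>: on the real line that square is positive wherever \<open>f\<close> does not vanish, hence off the branch
  cut.
\<close>

lemma log_abs_derivatives:
  assumes "real_entire f"
  shows "\<exists>D. D 0 = (\<lambda>x. ln \<bar>f x\<bar>) \<and>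
    (\<forall>n. \<forall>x\<in>{x. f x \<noteq> 0}. (D n has_real_derivative D (Suc n) x) (at x))"
proof -
  from assms obtain F where F: "F holomorphic_on UNIV"
    and f: "\<And>x. F (complex_of_real x) = complex_of_real (f x)"
    by (auto simp: real_entire_def)
  define T where "T = {z. F z ^ 2 \<notin> \<real>\<^sub>\<le>\<^sub>0}"
  have contF: "continuous_on UNIV F" by (rule holomorphic_on_imp_continuous_on[OF F])
  have "open ((\<lambda>z. F z ^ 2) -` (- \<real>\<^sub>\<le>\<^sub>0))"
    by (intro open_vimage continuous_intros contF) (auto simp: closed_nonpos_Reals_complex)
  then have T: "open T" by (simp add: T_def vimage_def)
  have 1: "(\<lambda>z. Ln (F z ^ 2) / 2) holomorphic_on T"
    unfolding T_def by (intro holomorphic_intros holomorphic_on_subset[OF F]) auto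
  have S: "open {x. f x \<noteq> 0}"
    by (intro open_Collect_neq real_entire_continuous[OF assms] continuous_intros)
  have "complex_of_real x \<in> T \<and> Ln (F (complex_of_real x) ^ 2) / 2 = complex_of_real (ln \<bar>f x\<bar>)"
    if "x \<in> {x. f x \<noteq> 0}" for x
  proof -
    have pos: "\<bar>f x\<bar> ^ 2 > 0" using that by auto
    have sq: "F (complex_of_real x) ^ 2 = complex_of_real (\<bar>f x\<bar> ^ 2)" by (simp add: f)
    have "Ln (complex_of_real (\<bar>f x\<bar> ^ 2)) = complex_of_real (ln (\<bar>f x\<bar> ^ 2))"
      using pos by (rule Ln_of_real)
    also have "ln (\<bar>f x\<bar> ^ 2) = 2 * ln \<bar>f x\<bar>" using that by (subst ln_realpow) auto
    finally have "Ln (F (complex_of_real x) ^ 2) / 2 = complex_of_real (ln \<bar>f x\<bar>)"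
      unfolding sq by simp
    moreover have "complex_of_real x \<in> T" using pos by (simp add: T_def sq del: of_real_power)
    ultimately show ?thesis by blast
  qed
  from holomorphic_extension_derivatives[OF 1 T S this] show ?thesis by simp
qed


text \<open>
  The arc works for every sufficiently small radius, so that two branches through the same point
  can be cut off by a common neighbourhood.
\<close>

lemma log_graph_arc:
  assumes f: "real_entire f" and V: "open V" and x0: "f x0 \<noteq> 0" "(x0, ln \<bar>f x0\<bar>) \<in> V"
  obtains d where "d > 0"
    "\<And>r. 0 < r \<Longrightarrow> r \<le> d \<Longrightarrow> smooth_embedded_arc (\<lambda>t. (x0 + r * t, ln \<bar>f (x0 + r * t)\<bar>))
      (log_graph f \<inter> V \<inter> {(x, y). \<bar>x - x0\<bar> < r})"
proof -
  define h where "h = (\<lambda>x. ln \<bar>f x\<bar>)"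
  obtain D where D0: "D 0 = h"
    and D: "\<And>n x. f x \<noteq> 0 \<Longrightarrow> (D n has_real_derivative D (Suc n) x) (at x)"
    using log_abs_derivatives[OF f] unfolding h_def by blast
  have S: "open {x. f x \<noteq> 0}"
    by (intro open_Collect_neq real_entire_continuous[OF f] continuous_intros)
  have cont: "continuous_on {x. f x \<noteq> 0} h"
    using D[of _ 0] unfolding D0 by (intro DERIV_continuous_on) (auto intro: has_field_derivative_at_within)
  have "open ({x. f x \<noteq> 0} \<inter> (\<lambda>x. (x, h x)) -` V)"
    by (intro continuous_open_preimage S V continuous_intros cont)
  moreover have "x0 \<in> {x. f x \<noteq> 0} \<inter> (\<lambda>x. (x, h x)) -` V"
    using x0 by (simp add: h_def)
  ultimately obtain d where d: "d > 0" "ball x0 d \<subseteq> {x. f x \<noteq> 0} \<inter> (\<lambda>x. (x, h x)) -` V"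
    by (rule openE)
  show thesis
  proof (rule that[OF d(1)])
    fix r assume r: "0 < r" "r \<le> d"
    let ?g = "\<lambda>t. (x0 + r * t, h (x0 + r * t))"
    let ?A = "log_graph f \<inter> V \<inter> {(x, y). \<bar>x - x0\<bar> < r}"
    have near: "f x \<noteq> 0" "(x, h x) \<in> V" if "\<bar>x - x0\<bar> < r" for x
      using that r d(2) by (auto simp: subset_iff dist_real_def abs_minus_commute)
    have small: "\<bar>x0 + r * t - x0\<bar> < r" if "t \<in> {-1<..<1}" for t
      using that r by (auto simp: abs_mult abs_less_iff)
    have A: "?A = {(x, h x) | x. \<bar>x - x0\<bar> < r}"
    proof (intro set_eqI iffI)
      fix p assume p: "p \<in> ?A"
      obtain x y where xy: "p = (x, y)" by (cases p)
      have "y = h x" using p ln_exp[of y] by (simp add: xy log_graph_def h_def)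
      then show "p \<in> {(x, h x) | x. \<bar>x - x0\<bar> < r}" using p xy by auto
    next
      fix p assume "p \<in> {(x, h x) | x. \<bar>x - x0\<bar> < r}"
      then obtain x where "p = (x, h x)" "\<bar>x - x0\<bar> < r" by blast
      then show "p \<in> ?A" using near[of x] by (simp add: log_graph_def h_def)
    qed
    define E where "E n t = ((if n = 0 then x0 + r * t else if n = 1 then r else 0),
      r ^ n * D n (x0 + r * t))" for n :: nat and t
    have "(E n has_vector_derivative E (Suc n) t) (at t)" if t: "t \<in> {-1<..<1}" for n t
    proof -
      have lin: "((\<lambda>t. x0 + r * t) has_real_derivative r) (at t)"
        by (auto intro!: derivative_eq_intros)
      have "((\<lambda>t. r ^ n * D n (x0 + r * t)) has_real_derivative r ^ Suc n * D (Suc n) (x0 + r * t)) (at t)"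
        using DERIV_cmult[OF DERIV_chain2[OF D[OF near(1)[OF small[OF t]]] lin], of "r ^ n" n]
        by (simp add: mult_ac)
      moreover have "((\<lambda>t. if n = 0 then x0 + r * t else if n = 1 then r else 0)
          has_real_derivative (if Suc n = 0 then x0 + r * t else if Suc n = 1 then r else 0)) (at t)"
        using lin by (cases "n = 0") auto
      ultimately show ?thesis
        unfolding E_def has_real_derivative_iff_has_vector_derivative
        by (intro has_vector_derivative_Pair)
    qed
    moreover have "E 0 = ?g" by (simp add: E_def D0 fun_eq_iff)
    moreover have "E 1 t \<noteq> 0" for t using r by (simp add: E_def prod_eq_iff)
    moreover have "homeomorphism {-1<..<1} ?A ?g (\<lambda>(x, y). (x - x0) / r)"
    proof (rule homeomorphismI)
      show "continuous_on {-1<..<1} ?g"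
        using near(1)[OF small] by (intro continuous_intros continuous_on_compose2[OF cont]) auto
      show "continuous_on ?A (\<lambda>(x, y). (x - x0) / r)"
        unfolding case_prod_unfold using r by (intro continuous_intros) auto
      show "?g ` {-1<..<1} \<subseteq> ?A" using small by (auto simp: A)
      show "(\<lambda>(x, y). (x - x0) / r) ` ?A \<subseteq> {-1<..<1}"
      proof
        fix t assume "t \<in> (\<lambda>(x, y). (x - x0) / r) ` ?A"
        then obtain x where "t = (x - x0) / r" "\<bar>x - x0\<bar> < r" unfolding A by auto
        then have "\<bar>t\<bar> < 1" using r by (simp add: abs_divide)
        then show "t \<in> {-1<..<1}" by (auto simp: abs_less_iff)
      qed
    qed (use r in \<open>auto simp: A\<close>)
    ultimately show "smooth_embedded_arc (\<lambda>t. (x0 + r * t, ln \<bar>f (x0 + r * t)\<bar>)) ?A"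
      unfolding smooth_embedded_arc_def h_def by blast
  qed
qed

lemma regular_at_log_graph:
  assumes f: "real_entire f" and U: "open U" "C \<inter> U = log_graph f \<inter> U" and p: "p \<in> C \<inter> U"
  shows "regular_at C p"
proof -
  obtain x y where xy: "p = (x, y)" by (cases p)
  have e: "exp y = \<bar>f x\<bar>" using p U xy by (auto simp: log_graph_def)
  then have fx: "f x \<noteq> 0" by (metis abs_zero exp_not_eq_zero)
  have y: "y = ln \<bar>f x\<bar>" using e ln_exp[of y] by simp
  obtain d where d: "d > 0" and arc: "\<And>r. 0 < r \<Longrightarrow> r \<le> d \<Longrightarrow>
      smooth_embedded_arc (\<lambda>t. (x + r * t, ln \<bar>f (x + r * t)\<bar>))
        (log_graph f \<inter> U \<inter> {(x', y). \<bar>x' - x\<bar> < r})"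
    using log_graph_arc[OF f U(1) fx] p xy y by blast
  have "open {(x', y :: real). \<bar>x' - x\<bar> < d}"
    unfolding case_prod_unfold by (intro open_Collect_less continuous_intros)
  then have "open (U \<inter> {(x', y). \<bar>x' - x\<bar> < d})" using U by blast
  moreover have "C \<inter> (U \<inter> {(x', y). \<bar>x' - x\<bar> < d}) = log_graph f \<inter> U \<inter> {(x', y). \<bar>x' - x\<bar> < d}"
    using U by blast
  ultimately show ?thesis
    unfolding regular_at_def using arc[OF d order_refl] p d xy
    by (intro conjI exI[of _ "U \<inter> {(x', y). \<bar>x' - x\<bar> < d}"]) auto
qed

text \<open>
  At a point of only one branch, the complement of the other branch is a neighbourhood in which
  the set is a single branch, because branches are closed.
\<close>

lemma regular_at_log_graph_union:
  assumes f: "real_entire f1" "real_entire f2"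
    and U: "open U" "C \<inter> U = (log_graph f1 \<union> log_graph f2) \<inter> U"
    and p: "(x, y) \<in> C \<inter> U" and ne: "\<bar>f1 x\<bar> \<noteq> \<bar>f2 x\<bar>"
  shows "regular_at C (x, y)"
proof -
  have away: "open (U \<inter> - log_graph f)" if "real_entire f" for f
  proof -
    have "closed (log_graph f)"
      unfolding log_graph_def case_prod_unfold
      by (intro closed_Collect_eq continuous_intros
          continuous_on_compose2[OF real_entire_continuous[OF that, of UNIV]]) auto
    then show ?thesis using U(1) by blast
  qed
  consider "(x, y) \<in> log_graph f1" "(x, y) \<notin> log_graph f2"
    | "(x, y) \<in> log_graph f2" "(x, y) \<notin> log_graph f1"
    using p U(2) ne by (auto simp: log_graph_def)
  then show ?thesis
  proof cases
    case 1
    then show ?thesis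
      using regular_at_log_graph[OF f(1) away[OF f(2)], of C "(x, y)"] p U(2) by blast
  next
    case 2
    then show ?thesis
      using regular_at_log_graph[OF f(2) away[OF f(1)], of C "(x, y)"] p U(2) by blast
  qed
qed

section \<open>Crossings are not regular\<close>

text \<open>
  A curve \<open>\<alpha>\<close> that runs inside an embedded arc is, by continuity of the inverse \<open>\<tau>\<close> of the
  parametrization \<open>\<gamma>\<close>, a reparametrization \<open>\<gamma> \<circ> s\<close> with \<open>s\<close> continuous, which need not be
  differentiable. Still, the difference quotients of \<open>\<alpha>\<close> at \<open>0\<close> are real multiples of those of \<open>\<gamma>\<close>
  at \<open>t0\<close>, so their determinant vanishes, and so does its limit, the determinant of the
  velocities.
\<close>

lemma curve_through_arc_tangent:
  fixes \<gamma> \<alpha> :: "real \<Rightarrow> real \<times> real"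
  assumes hom: "homeomorphism T A \<gamma> \<tau>" and t0: "t0 \<in> T" "\<gamma> t0 = \<alpha> 0"
    and v: "(\<gamma> has_vector_derivative v) (at t0)"
    and u: "(\<alpha> has_vector_derivative u) (at 0)"
    and A: "\<forall>\<^sub>F x in at 0. \<alpha> x \<in> A \<and> \<alpha> x \<noteq> \<alpha> 0"
  shows "fst u * snd v = snd u * fst v"
proof -
  define s where "s = (\<lambda>x. \<tau> (\<alpha> x))"
  have base: "\<alpha> 0 \<in> A" "\<tau> (\<alpha> 0) = t0"
    using hom t0 unfolding homeomorphism_def by (metis imageI, metis)
  have "filterlim \<alpha> (at (\<alpha> 0) within A) (at 0)"
    unfolding filterlim_at using A has_vector_derivative_continuous[OF u] by (simp add: continuous_within)
  moreover have "(\<tau> \<longlongrightarrow> t0) (at (\<alpha> 0) within A)"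
    using hom base unfolding homeomorphism_def continuous_on_def by metis
  ultimately have "(s \<longlongrightarrow> t0) (at 0)"
    unfolding s_def by (rule filterlim_compose[rotated])
  moreover have reparam: "\<forall>\<^sub>F x in at 0. \<gamma> (s x) = \<alpha> x \<and> s x \<noteq> t0"
    using A by eventually_elim (use hom t0(2) in \<open>auto simp: s_def homeomorphism_def\<close>)
  ultimately have s: "filterlim s (at t0) (at 0)"
    unfolding filterlim_at by (auto elim: eventually_mono)
  have quot: "((\<lambda>x. (l (\<alpha> x) - l (\<alpha> 0)) / x) \<longlongrightarrow> l u) (at 0)"
    "((\<lambda>x. (l (\<gamma> (s x)) - l (\<gamma> t0)) / (s x - t0)) \<longlongrightarrow> l v) (at 0)"
    if l: "bounded_linear l" for l :: "real \<times> real \<Rightarrow> real"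
  proof -
    have "((\<lambda>x. l (\<alpha> x)) has_real_derivative l u) (at 0)"
      "((\<lambda>x. l (\<gamma> x)) has_real_derivative l v) (at t0)"
      using bounded_linear.has_vector_derivative[OF l u] bounded_linear.has_vector_derivative[OF l v]
      by (simp_all add: has_real_derivative_iff_has_vector_derivative)
    then show "((\<lambda>x. (l (\<alpha> x) - l (\<alpha> 0)) / x) \<longlongrightarrow> l u) (at 0)"
      "((\<lambda>x. (l (\<gamma> (s x)) - l (\<gamma> t0)) / (s x - t0)) \<longlongrightarrow> l v) (at 0)"
      unfolding has_field_derivative_iff by (simp, intro filterlim_compose[OF _ s])
  qed
  note q1 = quot[OF bounded_linear_fst] and q2 = quot[OF bounded_linear_snd]
  have "((\<lambda>x. (fst (\<alpha> x) - fst (\<alpha> 0)) / x * ((snd (\<gamma> (s x)) - snd (\<gamma> t0)) / (s x - t0)) -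
      (snd (\<alpha> x) - snd (\<alpha> 0)) / x * ((fst (\<gamma> (s x)) - fst (\<gamma> t0)) / (s x - t0)))
    \<longlongrightarrow> fst u * snd v - snd u * fst v) (at 0)"
    by (intro tendsto_diff tendsto_mult q1 q2)
  moreover have "\<forall>\<^sub>F x in at 0.
      (fst (\<alpha> x) - fst (\<alpha> 0)) / x * ((snd (\<gamma> (s x)) - snd (\<gamma> t0)) / (s x - t0)) -
      (snd (\<alpha> x) - snd (\<alpha> 0)) / x * ((fst (\<gamma> (s x)) - fst (\<gamma> t0)) / (s x - t0)) = 0"
    using reparam by eventually_elim (simp add: t0(2))
  ultimately have "((\<lambda>x::real. 0) \<longlongrightarrow> fst u * snd v - snd u * fst v) (at 0)"
    by (rule Lim_transform_eventually)
  then show ?thesis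
    using LIM_const_eq by fastforce
qed

text \<open>
  In an embedded arc both velocities would be parallel to the nonzero velocity of the arc.
\<close>

lemma not_regular_at_crossing:
  fixes \<alpha> \<beta> :: "real \<Rightarrow> real \<times> real"
  assumes \<alpha>: "(\<alpha> has_vector_derivative u) (at 0)" "\<alpha> 0 = p" "\<forall>\<^sub>F x in at 0. \<alpha> x \<in> C \<and> \<alpha> x \<noteq> p"
    and \<beta>: "(\<beta> has_vector_derivative v) (at 0)" "\<beta> 0 = p" "\<forall>\<^sub>F x in at 0. \<beta> x \<in> C \<and> \<beta> x \<noteq> p"
    and cross: "fst u * snd v \<noteq> snd u * fst v"
  shows "\<not> regular_at C p"
proof
  assume "regular_at C p"
  then obtain U \<gamma> where U: "open U" "p \<in> U" "p \<in> C" and arc: "smooth_embedded_arc \<gamma> (C \<inter> U)"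
    by (auto simp: regular_at_def)
  then obtain D \<tau> where D: "D 0 = \<gamma>" "\<forall>n. \<forall>t\<in>{-1<..<1}. (D n has_vector_derivative D (Suc n) t) (at t)"
      "\<forall>t\<in>{-1<..<1}. D 1 t \<noteq> 0" and hom: "homeomorphism {-1<..<1} (C \<inter> U) \<gamma> \<tau>"
    unfolding smooth_embedded_arc_def by blast
  obtain t0 where t0: "t0 \<in> {-1<..<1}" "\<gamma> t0 = p"
    using hom U unfolding homeomorphism_def by (metis IntI imageE)
  have w: "(\<gamma> has_vector_derivative D 1 t0) (at t0)" using D(2)[rule_format, of t0 0] D(1) t0 by simp
  have near: "\<forall>\<^sub>F x in at 0. \<delta> x \<in> U" if "(\<delta> has_vector_derivative d) (at 0)" "\<delta> 0 = p" for \<delta> d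
    using has_vector_derivative_continuous[OF that(1)] that(2) U
    by (auto simp: continuous_within intro: topological_tendstoD)
  have "fst u * snd (D 1 t0) = snd u * fst (D 1 t0)"
    using near[OF \<alpha>(1,2)] \<alpha>
    by (intro curve_through_arc_tangent[OF hom t0(1) _ w \<alpha>(1)]) (auto simp: t0 elim: eventually_elim2)
  moreover have "fst v * snd (D 1 t0) = snd v * fst (D 1 t0)"
    using near[OF \<beta>(1,2)] \<beta>
    by (intro curve_through_arc_tangent[OF hom t0(1) _ w \<beta>(1)]) (auto simp: t0 elim: eventually_elim2)
  ultimately have "(fst u * snd v - snd u * fst v) * fst (D 1 t0) = 0"
      "(fst u * snd v - snd u * fst v) * snd (D 1 t0) = 0"
    by algebra+
  then have "D 1 t0 = 0" using cross by (simp add: prod_eq_iff)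
  then show False using D(3) t0 by blast
qed


section \<open>The polynomials supported on the vertices\<close>

lemma real_entire_exp_trinomial: "real_entire (\<lambda>x. a + b * exp x + c * exp (3 * x))"
  unfolding real_entire_def
proof (intro exI conjI allI)
  show "(\<lambda>z. of_real a + of_real b * exp z + of_real c * exp (3 * z)) holomorphic_on UNIV"
    by (intro holomorphic_intros)
  show "of_real a + of_real b * exp (complex_of_real x) + of_real c * exp (3 * complex_of_real x) =
      complex_of_real (a + b * exp x + c * exp (3 * x))" for x
    using exp_of_real[of "3 * x", where 'a = complex] by (simp add: exp_of_real)
qed

lemma simplex_polynomial_eq: "const2 a + const2 b * varz ^ 3 + const2 c * varw = [:[:a, 0, 0, b:], [:c:]:]"
  by (simp add: const2_def varz_def varw_def power3_eq_cube)

lemma f_node_eq: "f_node = [:[:-1, 1, 0, -1:], 1:]"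
  by (simp add: f_node_def varz_def varw_def power3_eq_cube one_pCons)

text \<open>
  With \<open>u = b z^3 / a\<close> the logarithmic Gauss map is \<open>3 u / (1 + u)\<close>, a Moebius transformation
  with real coefficients, so it is real exactly if \<open>u\<close> is. On the circle \<open>\<bar>z\<bar> = exp x\<close> this leaves
  the two values \<open>\<plusminus> \<bar>b / a\<bar> exp (3 x)\<close> of \<open>u\<close>, one for each branch. The middle term of both
  trinomials vanishes; it is kept to match \<open>real_entire_exp_trinomial\<close>.
\<close>

lemma contour_binomial:
  assumes nz: "a \<noteq> 0" "b \<noteq> 0" "c \<noteq> 0"
  shows "contour [:[:a, 0, 0, b:], [:c:]:] =
    log_graph (\<lambda>x. cmod (a / c) + 0 * exp x + cmod (b / c) * exp (3 * x)) \<union>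
    log_graph (\<lambda>x. cmod (a / c) + 0 * exp x + (- cmod (b / c)) * exp (3 * x))"
proof -
  define q where "q = [:a, 0, 0, b:]"
  have g: "eval2 [:[:a, 0, 0, b:], [:c:]:] (z, w) = poly q z + c * w" for z w
    by (simp add: eval2_def q_def algebra_simps)
  define u where "u z = b * z ^ 3 / a" for z
  have q: "poly q z = a * (1 + u z)" and q': "z * poly (pderiv q) z = a * (3 * u z)" for z
    using nz by (simp_all add: q_def u_def pderiv_pCons field_simps power3_eq_cube)
  have cu: "cmod (u z) = cmod (b / a) * exp (3 * x)" if "cmod z = exp x" for x z
    using that by (simp add: u_def norm_mult norm_divide norm_power exp_of_nat_mult[of 3 x, symmetric])
  have real: "Im (z * poly (pderiv q) z / poly q z) = 0 \<longleftrightarrow> Im (u z) = 0" if "poly q z \<noteq> 0" for z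
  proof
    assume "Im (z * poly (pderiv q) z / poly q z) = 0"
    then have "Im (3 * u z * cnj (1 + u z)) = 0"
      using nz that unfolding q q' by (simp add: Im_complex_div_eq_0 mult.assoc del: complex_cnj_add)
    then show "Im (u z) = 0" by (simp add: algebra_simps)
  next
    assume "Im (u z) = 0"
    then obtain t where "u z = of_real t" by (metis complex_is_Real_iff Reals_cases)
    then have "z * poly (pderiv q) z / poly q z = of_real (3 * t / (1 + t))"
      using nz by (simp add: q q')
    then show "Im (z * poly (pderiv q) z / poly q z) = 0" by (simp only: Im_complex_of_real)
  qed
  have scale: "cmod (a / c) * \<bar>1 + s * (cmod (b / a) * e)\<bar> = \<bar>cmod (a / c) + s * cmod (b / c) * e\<bar>" for s e
  proof -
    have "cmod (a / c) * \<bar>1 + s * (cmod (b / a) * e)\<bar> = \<bar>cmod (a / c) * (1 + s * (cmod (b / a) * e))\<bar>"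
      by (simp add: abs_mult)
    also have "cmod (a / c) * (1 + s * (cmod (b / a) * e)) = cmod (a / c) + s * cmod (b / c) * e"
      using nz by (simp add: norm_divide field_simps)
    finally show ?thesis .
  qed
  have "(x, y) \<in> contour [:[:a, 0, 0, b:], [:c:]:] \<longleftrightarrow>
      (\<exists>s\<in>{1, -1}. exp y = \<bar>cmod (a / c) + s * cmod (b / c) * exp (3 * x)\<bar>)" for x y
  proof -
    have "(x, y) \<in> contour [:[:a, 0, 0, b:], [:c:]:] \<longleftrightarrow>
        (\<exists>z. cmod z = exp x \<and> cmod (poly q z) = cmod c * exp y \<and> Im (u z) = 0)"
      unfolding contour_graph_iff[OF g nz(3)] using real nz(3)
      by (metis exp_not_eq_zero mult_eq_0_iff norm_eq_zero)
    also have "\<dots> \<longleftrightarrow> (\<exists>s\<in>{1, -1}. exp y = cmod (a / c) * \<bar>1 + s * (cmod (b / a) * exp (3 * x))\<bar>)"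
    proof
      assume "\<exists>z. cmod z = exp x \<and> cmod (poly q z) = cmod c * exp y \<and> Im (u z) = 0"
      then obtain z where z: "cmod z = exp x" "cmod (poly q z) = cmod c * exp y" "Im (u z) = 0" by blast
      then obtain t where t: "u z = of_real t" by (metis complex_is_Real_iff Reals_cases)
      have "\<bar>t\<bar> = cmod (b / a) * exp (3 * x)" using cu[OF z(1)] t by simp
      then obtain s where s: "s \<in> {1, -1}" "t = s * (cmod (b / a) * exp (3 * x))"
        by (cases "t \<ge> 0") (fastforce simp: abs_if)+
      have "1 + u z = of_real (1 + t)" by (simp add: t)
      then have "cmod (poly q z) = cmod a * \<bar>1 + t\<bar>" unfolding q by (simp only: norm_mult norm_of_real)
      then have "exp y = cmod (a / c) * \<bar>1 + t\<bar>" using z(2) nz by (simp add: norm_divide field_simps)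
      with s show "\<exists>s\<in>{1, -1}. exp y = cmod (a / c) * \<bar>1 + s * (cmod (b / a) * exp (3 * x))\<bar>" by blast
    next
      assume "\<exists>s\<in>{1, -1}. exp y = cmod (a / c) * \<bar>1 + s * (cmod (b / a) * exp (3 * x))\<bar>"
      then obtain s where s: "s \<in> {1, -1}"
        "exp y = cmod (a / c) * \<bar>1 + s * (cmod (b / a) * exp (3 * x))\<bar>" by blast
      define t where "t = s * (cmod (b / a) * exp (3 * x))"
      obtain z where z: "z ^ 3 = of_real t * a / b"
        using exists_complex_root[of 3 "of_real t * a / b"] by (metis zero_neq_numeral)
      have u: "u z = of_real t" using nz by (simp add: u_def z)
      have "cmod z ^ 3 = \<bar>t\<bar> * cmod a / cmod b"
        unfolding norm_power[symmetric] z by (simp add: norm_mult norm_divide)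
      also have "\<bar>t\<bar> = cmod (b / a) * exp (3 * x)" using s(1) by (auto simp: t_def abs_mult)
      also have "\<dots> * cmod a / cmod b = exp x ^ 3"
        using nz by (simp add: norm_divide exp_of_nat_mult[of 3 x, symmetric])
      finally have "cmod z = exp x" by (rule power_eq_imp_eq_base) auto
      moreover have "1 + u z = of_real (1 + t)" by (simp add: u)
      then have "cmod (poly q z) = cmod a * \<bar>1 + t\<bar>" unfolding q by (simp only: norm_mult norm_of_real)
      then have "cmod (poly q z) = cmod c * exp y"
        using s(2) nz by (simp add: norm_divide t_def)
      ultimately show "\<exists>z. cmod z = exp x \<and> cmod (poly q z) = cmod c * exp y \<and> Im (u z) = 0"
        using u by auto
    qed
    finally show ?thesis by (simp only: scale)
  qed
  then show ?thesis by (auto simp: log_graph_def)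
qed

lemma contour_binomial_smooth:
  assumes "a \<noteq> 0" "b \<noteq> 0" "c \<noteq> 0"
  shows "singular_points (contour [:[:a, 0, 0, b:], [:c:]:]) = {}"
proof -
  have "regular_at (contour [:[:a, 0, 0, b:], [:c:]:]) (x, y)"
    if "(x, y) \<in> contour [:[:a, 0, 0, b:], [:c:]:]" for x y
  proof (rule regular_at_log_graph_union[OF real_entire_exp_trinomial real_entire_exp_trinomial open_UNIV])
    have "cmod (a / c) > 0" "cmod (b / c) * exp (3 * x) > 0" using assms by auto
    then show "\<bar>cmod (a / c) + 0 * exp x + cmod (b / c) * exp (3 * x)\<bar> \<noteq>
        \<bar>cmod (a / c) + 0 * exp x + (- cmod (b / c)) * exp (3 * x)\<bar>"
      by linarith
  qed (use that contour_binomial[OF assms] in auto)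
  then show ?thesis by (auto simp: singular_points_def)
qed


section \<open>The node\<close>

text \<open>
  On the curve of \<open>f_node\<close>, the functions \<open>node_branch1\<close> and \<open>node_branch2\<close> are the values of \<open>w\<close>
  at \<open>z = exp x\<close> and at \<open>z = - exp x\<close>. Trivial coefficients are written out to match
  \<open>real_entire_exp_trinomial\<close>.
\<close>

abbreviation node_branch1 :: "real \<Rightarrow> real" where
  "node_branch1 \<equiv> \<lambda>x. 1 + (-1) * exp x + 1 * exp (3 * x)"

abbreviation node_branch2 :: "real \<Rightarrow> real" where
  "node_branch2 \<equiv> \<lambda>x. 1 + 1 * exp x + (-1) * exp (3 * x)"

text \<open>
  The numerator of the imaginary part of the logarithmic Gauss map factors as \<open>Im z\<close> times a real
  cubic \<open>P\<close>. On \<open>\<bar>z\<bar> = 1\<close> the condition \<open>\<bar>q(z)\<bar> = 1\<close> reads \<open>(2 Re z - 1) ((Re z)^2 - 1) = 0\<close>, while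
  \<open>P = 0\<close> reads \<open>3 (Re z)^2 - Re z - 1 = 0\<close>; these have no common root. Hence nonreal critical points
  do not accumulate at the fibre over the origin.
\<close>

lemma contour_f_node_near_origin:
  obtains V where "open V" "(0, 0) \<in> V"
    "contour f_node \<inter> V = (log_graph node_branch1 \<union> log_graph node_branch2) \<inter> V"
proof -
  define q where "q = [:-1, 1, 0, -1 :: complex:]"
  define P where "P z = 9 * Re z ^ 2 - 3 * Im z ^ 2 - 4 * (Re z ^ 2 + Im z ^ 2) * Re z - 1" for z
  have g: "eval2 f_node (z, w) = poly q z + 1 * w" for z w
    by (simp add: f_node_eq eval2_def q_def)
  have q: "poly q z = -1 + z - z ^ 3" and q': "z * poly (pderiv q) z = z - 3 * z ^ 3" for z
    by (simp_all add: q_def pderiv_pCons algebra_simps power3_eq_cube)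
  have crit: "Im (z * poly (pderiv q) z / poly q z) = 0 \<longleftrightarrow> Im z = 0 \<or> P z = 0" for z
  proof -
    have "Im ((z - 3 * z ^ 3) * cnj (-1 + z - z ^ 3)) = Im z * P z"
      unfolding P_def by (simp add: power3_eq_cube power2_eq_square algebra_simps)
    then show ?thesis by (simp add: Im_complex_div_eq_0 q q')
  qed
  \<comment> \<open>The bound makes \<open>K\<close> compact; any number above \<open>1\<close> would do.\<close>
  define K where "K = {z. cmod z \<le> 2 \<and> P z = 0}"
  \<comment> \<open>Zero exactly on the fibre over the origin, measured in exponential coordinates.\<close>
  define m where "m z = \<bar>cmod z - 1\<bar> + \<bar>cmod (poly q z) - 1\<bar>" for z
  have pos: "m z > 0" if "z \<in> K" for z
  proof (rule ccontr)
    assume "\<not> m z > 0"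
    then have "cmod z = 1" "cmod (poly q z) = 1" unfolding m_def by linarith+
    then have 1: "Re z ^ 2 + Im z ^ 2 = 1" and 2: "cmod (poly q z) ^ 2 = 1"
      by (simp_all flip: cmod_power2)
    have 3: "P z = 0" using that by (simp add: K_def)
    have "cmod (poly q z) ^ 2 =
        (-1 + Re z - Re z * (Re z ^ 2 - 3 * Im z ^ 2)) ^ 2 + (Im z - Im z * (3 * Re z ^ 2 - Im z ^ 2)) ^ 2"
      unfolding q cmod_power2 by (simp add: power3_eq_cube power2_eq_square algebra_simps)
    then have "(2 * Re z - 1) * (Re z ^ 2 - 1) = 0"
      using 1 2 by algebra
    then consider "Re z = 1/2" | "Re z = 1" | "Re z = -1"
      by (auto simp: power2_eq_1_iff)
    moreover have "3 * Re z ^ 2 - Re z - 1 = 0"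
      using 1 3 unfolding P_def by algebra
    ultimately show False by cases (simp_all add: power2_eq_square)
  qed
  have "\<exists>e>0. \<forall>z\<in>K. e \<le> m z"
  proof (cases "K = {}")
    case False
    have "closed K"
      unfolding K_def P_def by (intro closed_Collect_conj closed_Collect_le closed_Collect_eq continuous_intros)
    moreover have "bounded K" unfolding K_def bounded_iff by (intro exI[of _ 2]) auto
    ultimately have "compact K" by (simp add: compact_eq_bounded_closed)
    moreover have "continuous_on K m"
      unfolding m_def by (intro continuous_intros)
    ultimately obtain z where "z \<in> K" "\<forall>z'\<in>K. m z \<le> m z'"
      using continuous_attains_inf[of K m] False by blast
    then show ?thesis using pos by blast
  qed (auto intro: exI[of _ 1])
  then obtain e where e: "e > 0" "\<And>z. z \<in> K \<Longrightarrow> e \<le> m z" by blast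
  define V where "V = {p. exp (fst p) < 2 \<and>
    \<bar>exp (fst p) - 1\<bar> + \<bar>exp (snd p) - 1\<bar> < (e :: real)}"
  have "open V"
    unfolding V_def by (intro open_Collect_conj open_Collect_less continuous_intros)
  moreover have "(0, 0) \<in> V" using e by (simp add: V_def)
  moreover have "(x, y) \<in> contour f_node \<longleftrightarrow> (x, y) \<in> log_graph node_branch1 \<union> log_graph node_branch2"
    if V: "(x, y) \<in> V" for x y
  proof -
    have c: "(x, y) \<in> contour f_node \<longleftrightarrow>
        (\<exists>z. cmod z = exp x \<and> cmod (poly q z) = exp y \<and> (Im z = 0 \<or> P z = 0))"
      unfolding contour_graph_iff[OF g one_neq_zero] crit by simp
    have cube: "exp (3 * x) = exp x ^ 3" by (simp add: exp_of_nat_mult[of 3 x, symmetric])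
    have qreal: "cmod (poly q (of_real t)) = \<bar>-1 + t - t ^ 3\<bar>" for t
    proof -
      have "poly q (of_real t) = of_real (-1 + t - t ^ 3)" by (simp add: q)
      then show ?thesis by (simp only: norm_of_real)
    qed
    show ?thesis
    proof
      assume "(x, y) \<in> contour f_node"
      then obtain z where z: "cmod z = exp x" "cmod (poly q z) = exp y" "Im z = 0 \<or> P z = 0"
        using c by blast
      have "z \<notin> K" using e(2)[of z] V z by (auto simp: V_def m_def)
      then have "Im z = 0" using V z by (auto simp: K_def V_def)
      then obtain t where t: "z = of_real t" by (metis complex_is_Real_iff Reals_cases)
      then have y: "exp y = \<bar>-1 + t - t ^ 3\<bar>" using z qreal by simp
      have "t = exp x \<or> t = - exp x" using z(1) t by auto
      then show "(x, y) \<in> log_graph node_branch1 \<union> log_graph node_branch2"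
        using y by (auto simp: log_graph_def cube abs_if)
    next
      assume *: "(x, y) \<in> log_graph node_branch1 \<union> log_graph node_branch2"
      have "\<exists>t. \<bar>t\<bar> = exp x \<and> \<bar>-1 + t - t ^ 3\<bar> = exp y"
      proof (cases "(x, y) \<in> log_graph node_branch1")
        case True
        then show ?thesis by (intro exI[of _ "exp x"]) (auto simp: log_graph_def cube)
      next
        case False
        then show ?thesis using * by (intro exI[of _ "- exp x"]) (auto simp: log_graph_def cube)
      qed
      then obtain t where "\<bar>t\<bar> = exp x" "\<bar>-1 + t - t ^ 3\<bar> = exp y" by blast
      then show "(x, y) \<in> contour f_node"
        unfolding c by (intro exI[of _ "of_real t"]) (simp add: qreal)
    qed
  qed
  ultimately show thesis by (intro that[of V]) auto
qed

lemma log_abs_has_derivative: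
  assumes "(f has_real_derivative d) (at x)" "f x > 0"
  shows "((\<lambda>x. ln \<bar>f x\<bar>) has_real_derivative d / f x) (at x)"
proof -
  have "((\<lambda>x. ln (f x)) has_real_derivative d / f x) (at x)"
    using DERIV_chain2[OF DERIV_ln_divide assms(1)] assms(2) by simp
  moreover have "\<forall>\<^sub>F t in nhds x. f t > 0"
    using order_tendstoD(1)[OF DERIV_isCont[OF assms(1), unfolded isCont_def] assms(2)] assms(2)
    by (simp add: eventually_nhds_conv_at)
  then have "\<forall>\<^sub>F t in nhds x. ln (f t) = ln \<bar>f t\<bar>"
    by eventually_elim simp
  ultimately show ?thesis
    using DERIV_cong_ev[OF refl _ refl, of "\<lambda>t. ln (f t)" "\<lambda>t. ln \<bar>f t\<bar>" x] by blast
qed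

lemma node_branch_tangents:
  "((\<lambda>t. (r * t, ln \<bar>node_branch1 (r * t)\<bar>)) has_vector_derivative (r, 2 * r)) (at 0)"
  "((\<lambda>t. (r * t, ln \<bar>node_branch2 (r * t)\<bar>)) has_vector_derivative (r, - 2 * r)) (at 0)"
proof -
  have 0: "((\<lambda>t. r * t) has_real_derivative r) (at 0)"
    by (auto intro!: derivative_eq_intros)
  have 1: "((\<lambda>t. node_branch1 (r * t)) has_real_derivative 2 * r) (at 0)"
    by (auto intro!: derivative_eq_intros)
  have 2: "((\<lambda>t. node_branch2 (r * t)) has_real_derivative - 2 * r) (at 0)"
    by (auto intro!: derivative_eq_intros)
  from has_vector_derivative_Pair[OF 0[unfolded has_real_derivative_iff_has_vector_derivative]
      log_abs_has_derivative[OF 1, unfolded has_real_derivative_iff_has_vector_derivative]]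
  show "((\<lambda>t. (r * t, ln \<bar>node_branch1 (r * t)\<bar>)) has_vector_derivative (r, 2 * r)) (at 0)"
    by simp
  from has_vector_derivative_Pair[OF 0[unfolded has_real_derivative_iff_has_vector_derivative]
      log_abs_has_derivative[OF 2, unfolded has_real_derivative_iff_has_vector_derivative]]
  show "((\<lambda>t. (r * t, ln \<bar>node_branch2 (r * t)\<bar>)) has_vector_derivative (r, - 2 * r)) (at 0)"
    by simp
qed

lemma ordinary_node_f_node: "ordinary_node (contour f_node) (0, 0)"
proof -
  obtain V where V: "open V" "(0, 0) \<in> V"
    and C: "contour f_node \<inter> V = (log_graph node_branch1 \<union> log_graph node_branch2) \<inter> V"
    by (rule contour_f_node_near_origin)
  have arc: "\<exists>d>0. \<forall>r. 0 < r \<and> r \<le> d \<longrightarrow> smooth_embedded_arc (\<lambda>t. (r * t, ln \<bar>f (r * t)\<bar>))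
      (log_graph f \<inter> V \<inter> {(x, y). \<bar>x\<bar> < r})" if "real_entire f" "f 0 = 1" for f
  proof -
    have "f 0 \<noteq> 0" "(0, ln \<bar>f 0\<bar>) \<in> V" using that(2) V(2) by simp_all
    from log_graph_arc[OF that(1) V(1) this] obtain d where "d > 0"
      "\<And>r. 0 < r \<Longrightarrow> r \<le> d \<Longrightarrow> smooth_embedded_arc (\<lambda>t. (0 + r * t, ln \<bar>f (0 + r * t)\<bar>))
        (log_graph f \<inter> V \<inter> {(x, y). \<bar>x - 0\<bar> < r})"
      by blast
    then show ?thesis by auto
  qed
  from arc[OF real_entire_exp_trinomial, of 1 "-1" 1]
  obtain d1 where d1: "d1 > 0" "\<And>r. 0 < r \<Longrightarrow> r \<le> d1 \<Longrightarrow> smooth_embedded_arc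
      (\<lambda>t. (r * t, ln \<bar>node_branch1 (r * t)\<bar>)) (log_graph node_branch1 \<inter> V \<inter> {(x, y). \<bar>x\<bar> < r})"
    by auto
  from arc[OF real_entire_exp_trinomial, of 1 1 "-1"]
  obtain d2 where d2: "d2 > 0" "\<And>r. 0 < r \<Longrightarrow> r \<le> d2 \<Longrightarrow> smooth_embedded_arc
      (\<lambda>t. (r * t, ln \<bar>node_branch2 (r * t)\<bar>)) (log_graph node_branch2 \<inter> V \<inter> {(x, y). \<bar>x\<bar> < r})"
    by auto
  define r where "r = min d1 d2"
  have r: "r > 0" "r \<le> d1" "r \<le> d2" using d1 d2 by (auto simp: r_def)
  define B where "B = {(x, y :: real). \<bar>x\<bar> < r}"
  let ?a = "\<lambda>t. (r * t, ln \<bar>node_branch1 (r * t)\<bar>)" and ?b = "\<lambda>t. (r * t, ln \<bar>node_branch2 (r * t)\<bar>)"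
  have "open B"
    unfolding B_def case_prod_unfold by (intro open_Collect_less continuous_intros)
  then have "open (V \<inter> B)" using V by blast
  moreover have "(0, 0) \<in> V \<inter> B" using V r by (simp add: B_def)
  moreover have "contour f_node \<inter> (V \<inter> B) = (log_graph node_branch1 \<inter> V \<inter> B) \<union> (log_graph node_branch2 \<inter> V \<inter> B)"
    using C by blast
  moreover have "smooth_embedded_arc ?a (log_graph node_branch1 \<inter> V \<inter> B)"
    "smooth_embedded_arc ?b (log_graph node_branch2 \<inter> V \<inter> B)"
    unfolding B_def by (rule d1(2)[OF r(1,2)], rule d2(2)[OF r(1,3)])
  moreover have "?a 0 = (0, 0)" "?b 0 = (0, 0)" by simp_all
  moreover have "span {vector_derivative ?a (at 0), vector_derivative ?b (at 0)} = UNIV"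
  proof -
    have "(x, y) \<in> span {(r, 2 * r), (r, - 2 * r)}" for x y
    proof -
      have "((2 * x + y) / (4 * r)) *\<^sub>R (r, 2 * r) + ((2 * x - y) / (4 * r)) *\<^sub>R (r, - 2 * r)
          \<in> span {(r, 2 * r), (r, - 2 * r)}"
        by (intro span_add span_scale span_base) auto
      also have "((2 * x + y) / (4 * r)) *\<^sub>R (r, 2 * r) + ((2 * x - y) / (4 * r)) *\<^sub>R (r, - 2 * r) = (x, y)"
        using r by (simp add: field_simps)
      finally show ?thesis .
    qed
    then show ?thesis
      unfolding vector_derivative_at[OF node_branch_tangents(1)] vector_derivative_at[OF node_branch_tangents(2)]
      by auto
  qed
  ultimately show ?thesis unfolding ordinary_node_def by blast
qed

text \<open>
  The two branches meet where \<open>1 - X + X^3 = \<plusminus> (1 + X - X^3)\<close> for \<open>X = exp x\<close>. The minus sign is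
  impossible, and the plus sign gives \<open>X = 1\<close>. So the origin is the only candidate for a singular
  point nearby, and there the branches cross with different slopes.
\<close>

lemma origin_isolated_singularity_f_node: "(0, 0) \<in> isolated_singularities (contour f_node)"
proof -
  obtain V where V: "open V" "(0, 0) \<in> V"
    and C: "contour f_node \<inter> V = (log_graph node_branch1 \<union> log_graph node_branch2) \<inter> V"
    by (rule contour_f_node_near_origin)
  have on_contour: "\<forall>\<^sub>F x in at 0. (1 * x, ln \<bar>f (1 * x)\<bar>) \<in> contour f_node \<and> (1 * x, ln \<bar>f (1 * x)\<bar>) \<noteq> (0, 0)"
    if f: "f = node_branch1 \<or> f = node_branch2"
      and d: "((\<lambda>t. (1 * t, ln \<bar>f (1 * t)\<bar>)) has_vector_derivative d) (at 0)" for f d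
  proof -
    have "real_entire f" using f real_entire_exp_trinomial by blast
    then have "isCont f 0" using real_entire_continuous[of f UNIV] by (simp add: continuous_on_eq_continuous_at)
    moreover have "f 0 \<noteq> 0" using f by auto
    ultimately have "\<forall>\<^sub>F x in at 0. f x \<noteq> 0"
      unfolding isCont_def by (rule tendsto_imp_eventually_ne)
    moreover have "\<forall>\<^sub>F x in at 0. (1 * x, ln \<bar>f (1 * x)\<bar>) \<in> V"
      using has_vector_derivative_continuous[OF d] V f
      by (auto simp: continuous_within intro: topological_tendstoD)
    moreover have "\<forall>\<^sub>F x in at (0 :: real). x \<noteq> 0" by (simp add: eventually_at_filter)
    ultimately show ?thesis
    proof eventually_elim
      case (elim x)
      then have "(1 * x, ln \<bar>f (1 * x)\<bar>) \<in> log_graph f" by (simp add: log_graph_def)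
      then show ?case using elim C f by (auto simp del: mult_1)
    qed
  qed
  have "\<not> regular_at (contour f_node) (0, 0)"
    by (rule not_regular_at_crossing[OF node_branch_tangents(1)[of 1] _ on_contour[OF _ node_branch_tangents(1)[of 1]]
          node_branch_tangents(2)[of 1] _ on_contour[OF _ node_branch_tangents(2)[of 1]]]) simp_all
  moreover have origin: "(0, 0) \<in> contour f_node"
    using V C by (auto simp: log_graph_def)
  moreover have "regular_at (contour f_node) (x, y)"
    if p: "(x, y) \<in> contour f_node \<inter> V" "(x, y) \<noteq> (0, 0)" for x y
  proof (rule regular_at_log_graph_union[OF real_entire_exp_trinomial real_entire_exp_trinomial V(1) C p(1)])
    show "\<bar>node_branch1 x\<bar> \<noteq> \<bar>node_branch2 x\<bar>"
    proof
      assume "\<bar>node_branch1 x\<bar> = \<bar>node_branch2 x\<bar>"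
      then have "exp (3 * x) = exp x" by linarith
      then have "x = 0" by simp
      moreover have "(x, y) \<in> log_graph node_branch1 \<union> log_graph node_branch2" using p C by blast
      ultimately have "exp y = 1" by (auto simp: log_graph_def)
      with \<open>x = 0\<close> p(2) show False by simp
    qed
  qed
  ultimately have "V \<inter> singular_points (contour f_node) = {(0, 0)}"
    using V by (fastforce simp: singular_points_def)
  then show ?thesis
    using V unfolding isolated_singularities_def isolated_in_def by blast
qed

section \<open>Newton polygons and the supremum\<close>

lemma vertices_Delta: "vertices Delta = {(0, 0), (3, 0), (0, 1)}"
proof -
  have "\<not> collinear {(0, 0), (3, 0), (0, 1) :: real \<times> real}"
  proof
    assume "collinear {(0, 0), (3, 0), (0, 1) :: real \<times> real}"
    then obtain u where u: "\<And>x y. x \<in> {(0, 0), (3, 0), (0, 1)} \<Longrightarrow> y \<in> {(0, 0), (3, 0), (0, 1)} \<Longrightarrow>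
        \<exists>c. x - y = c *\<^sub>R (u :: real \<times> real)"
      unfolding collinear_def by blast
    obtain c where "(3, 0) = c *\<^sub>R u" using u[of "(3, 0)" "(0, 0)"] by auto
    moreover obtain d where "(0, 1) = d *\<^sub>R u" using u[of "(0, 1)" "(0, 0)"] by auto
    ultimately show False by (cases u) auto
  qed
  then have "\<not> affine_dependent {(0, 0), (3, 0), (0, 1) :: real \<times> real}"
    by (simp add: collinear_3_eq_affine_dependent)
  then show ?thesis
    by (auto simp: vertices_def Delta_def extreme_point_of_convex_hull_affine_independent)
qed

lemma coeff_bipoly:
  "coeff (coeff [:[:a, d, 0, b:], [:c:]:] j) i =
    (if j = 0 then if i = 0 then a else if i = 1 then d else if i = 3 then b else 0
     else if j = 1 \<and> i = 0 then c else 0)" for a :: complex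
proof -
  have "coeff [:a, d, 0, b:] i = (if i = 0 then a else if i = 1 then d else if i = 3 then b else 0)"
    by (simp add: coeff_pCons numeral_3_eq_3 split: nat.split)
  then show ?thesis
    by (simp add: coeff_pCons[of "[:a, d, 0, b:]"] coeff_pCons[of _ 0] split: nat.split)
qed

lemma real_support_simplex_iff:
  "real_support g = {(0, 0), (3, 0), (0, 1)} \<longleftrightarrow>
    (\<exists>a b c. g = [:[:a, 0, 0, b:], [:c:]:] \<and> a \<noteq> 0 \<and> b \<noteq> 0 \<and> c \<noteq> 0)"
proof -
  have inj: "inj (\<lambda>(i, j). (real i, real j))" by (auto simp: inj_on_def)
  have "real_support g = {(0, 0), (3, 0), (0, 1)} \<longleftrightarrow>
      (\<lambda>(i, j). (real i, real j)) ` support2 g = (\<lambda>(i, j). (real i, real j)) ` {(0, 0), (3, 0), (0, 1)}"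
    by (simp add: real_support_def)
  also have "\<dots> \<longleftrightarrow> support2 g = {(0, 0), (3, 0), (0, 1)}"
    by (rule inj_image_eq_iff[OF inj])
  also have "\<dots> \<longleftrightarrow> (\<exists>a b c. g = [:[:a, 0, 0, b:], [:c:]:] \<and> a \<noteq> 0 \<and> b \<noteq> 0 \<and> c \<noteq> 0)"
  proof
    assume s: "support2 g = {(0, 0), (3, 0), (0, 1)}"
    then have nz: "coeff (coeff g j) i \<noteq> 0 \<longleftrightarrow> (i, j) \<in> {(0, 0), (3, 0), (0, 1)}" for i j
      unfolding s[symmetric] by (simp add: support2_def)
    have "g = [:[:coeff (coeff g 0) 0, 0, 0, coeff (coeff g 0) 3:], [:coeff (coeff g 1) 0:]:]"
    proof (intro poly_eqI)
      fix j i
      show "coeff (coeff g j) i = coeff (coeff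
          [:[:coeff (coeff g 0) 0, 0, 0, coeff (coeff g 0) 3:], [:coeff (coeff g 1) 0:]:] j) i"
        using nz[of j i] unfolding coeff_bipoly by auto
    qed
    then show "\<exists>a b c. g = [:[:a, 0, 0, b:], [:c:]:] \<and> a \<noteq> 0 \<and> b \<noteq> 0 \<and> c \<noteq> 0"
      using nz by blast
  next
    assume "\<exists>a b c. g = [:[:a, 0, 0, b:], [:c:]:] \<and> a \<noteq> 0 \<and> b \<noteq> 0 \<and> c \<noteq> 0"
    then show "support2 g = {(0, 0), (3, 0), (0, 1)}"
      by (auto simp: support2_def coeff_bipoly simp del: coeff_pCons_0 coeff_pCons_Suc split: if_splits)
  qed
  finally show ?thesis .
qed

text \<open>
  The additional exponent \<open>(1, 0)\<close> lies on an edge of the triangle.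
\<close>

lemma newton_polygon_f_node: "newton_polygon f_node = Delta"
proof -
  have "support2 f_node = {(1, 0), (0, 0), (3, 0), (0, 1)}"
    unfolding f_node_eq support2_def one_pCons coeff_bipoly by (auto split: if_splits)
  then have "real_support f_node = insert (1, 0) {(0, 0), (3, 0), (0, 1)}"
    by (simp add: real_support_def)
  moreover have "(1, 0) \<in> convex hull {(0, 0), (3, 0), (0, 1) :: real \<times> real}"
  proof -
    have "(2/3) *\<^sub>R (0, 0) + (1/3) *\<^sub>R (3, 0) \<in> convex hull {(0, 0), (3, 0), (0, 1) :: real \<times> real}"
      by (intro convexD convex_convex_hull hull_inc) auto
    then show ?thesis by simp
  qed
  ultimately show ?thesis
    by (simp add: newton_polygon_def Delta_def hull_redundant)
qed

theorem theorem7p1: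
  shows "vertices Delta = {(0, 0), (3, 0), (0, 1)} \<and>
    {g. real_support g = vertices Delta} =
           {const2 a + const2 b * varz ^ 3 + const2 c * varw | a b c. a \<noteq> 0 \<and> b \<noteq> 0 \<and> c \<noteq> 0} \<and>
    (\<forall>g. real_support g = vertices Delta \<longrightarrow> singular_points (contour g) = {}) \<and>
    newton_polygon f_node = Delta \<and>
    ordinary_node (contour f_node) (0, 0) \<and>
    \<not> (\<exists>g. real_support g = vertices Delta \<and>
             num_isolated_singularities (contour g) =
               (SUP h\<in>{h. newton_polygon h = Delta}. num_isolated_singularities (contour h)))"
proof (intro conjI)
  show smooth: "\<forall>g. real_support g = vertices Delta \<longrightarrow> singular_points (contour g) = {}"
    using contour_binomial_smooth by (auto simp: vertices_Delta real_support_simplex_iff)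
  show "{g. real_support g = vertices Delta} =
      {const2 a + const2 b * varz ^ 3 + const2 c * varw | a b c. a \<noteq> 0 \<and> b \<noteq> 0 \<and> c \<noteq> 0}"
    by (simp only: vertices_Delta real_support_simplex_iff simplex_polynomial_eq)
  show "\<not> (\<exists>g. real_support g = vertices Delta \<and>
             num_isolated_singularities (contour g) =
               (SUP h\<in>{h. newton_polygon h = Delta}. num_isolated_singularities (contour h)))"
  proof
    assume "\<exists>g. real_support g = vertices Delta \<and>
             num_isolated_singularities (contour g) =
               (SUP h\<in>{h. newton_polygon h = Delta}. num_isolated_singularities (contour h))"
    then obtain g where "singular_points (contour g) = {}" and max: "num_isolated_singularities (contour g) =
               (SUP h\<in>{h. newton_polygon h = Delta}. num_isolated_singularities (contour h))"
      using smooth by blast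
    then have "num_isolated_singularities (contour g) = 0"
      by (simp add: num_isolated_singularities_def isolated_singularities_def isolated_in_def zero_enat_def)
    moreover have "num_isolated_singularities (contour f_node) \<le> num_isolated_singularities (contour g)"
      unfolding max by (intro SUP_upper) (simp add: newton_polygon_f_node)
    ultimately have "num_isolated_singularities (contour f_node) = 0" by simp
    then show False
      using origin_isolated_singularity_f_node
      by (auto simp: num_isolated_singularities_def zero_enat_def split: if_splits)
  qed
qed (rule vertices_Delta newton_polygon_f_node ordinary_node_f_node)+

end
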